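(* For any graph $G$ of order $n$, \[ 1\leqslant (\chi_2(G)\chi_2(\overline{G}))^{1/2}\leqslant \frac{\chi_2(G)+\chi_2(\overline{G})}{2}\leqslant \frac{n+1}{2}. \]
   Context: All graphs are finite and simple; the order of a graph is its number of vertices, and $\overline{G}$ denotes the complement of $G$ (same vertex set, $uv$ an edge of $\overline{G}$ iff $uv$ is not an edge of $G$). For a graph $G$, $d(u,v)$ is the length of a shortest $(u,v)$-path in $G$. A mapping $f:V(G)\to\{1,\ldots,k\}$ is a 2-proper $k$-coloring of $G$ if $f(u)\neq f(v)$ whenever $d(u,v)=2$ (adjacent vertices may receive the same color). The 2-proper chromatic number $\chi_2(G)$ is the minimum $k$ such that $G$ has a 2-proper $k$-coloring. *)

theory Defs
  imports "Graph_Theory.Pair_Digraph" "Graph_Theory.Shortest_Path"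
begin

definition graph_complement :: "'a pair_pre_digraph \<Rightarrow> 'a pair_pre_digraph" where
  "graph_complement G =
     \<lparr> pverts = pverts G,
       parcs = {(u, v). u \<in> pverts G \<and> v \<in> pverts G \<and> u \<noteq> v \<and> (u, v) \<notin> parcs G} \<rparr>"

lemma pair_graph_complement:
  assumes "pair_graph G"
  shows "pair_graph (graph_complement G)"
proof -
  interpret pair_graph G by fact
  have "finite (parcs (graph_complement G))"
    by (rule finite_subset[of _ "pverts G \<times> pverts G"])
       (auto simp: graph_complement_def pair_finite_verts)
  moreover have "(v, u) \<in> parcs G" if "(u, v) \<in> parcs G" for u v
    using that pair_sym_arcs by (auto simp: symmetric_def sym_def)
  ultimately show ?thesis
    by unfold_locales
       (auto simp: graph_complement_def pair_finite_verts symmetric_def sym_def)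
qed

text \<open>
  Unit arc weights turn the weighted shortest-path distance into the number of edges;
  it is \<open>\<infinity>\<close> between different components.
\<close>

definition graph_dist :: "'a pair_pre_digraph \<Rightarrow> 'a \<Rightarrow> 'a \<Rightarrow> ereal" where
  "graph_dist G u v = wf_digraph.\<mu> (with_proj G) (\<lambda>_. 1) u v"

text \<open>
  The infimum over walks in the definition of \<open>\<mu>\<close> is the one over paths.
\<close>

lemma graph_dist_path:
  assumes "pair_graph G"
  shows "graph_dist G u v =
    (INF p \<in> {p. pre_digraph.apath (with_proj G) u p v}. ereal (real (length p)))"
proof -
  interpret pair_graph G by fact
  have len: "awalk_cost (\<lambda>_. 1) p = real (length p)" for p :: "('a \<times> 'a) list"
    by (induct p) (auto simp: awalk_cost_def)
  show ?thesis
    unfolding graph_dist_def \<mu>_def len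
  proof (rule antisym)
    show "(INF p\<in>{p. awalk u p v}. ereal (real (length p)))
        \<le> (INF p\<in>{p. apath u p v}. ereal (real (length p)))"
      by (rule INF_superset_mono) (auto simp: apath_def)
  next
    show "(INF p\<in>{p. apath u p v}. ereal (real (length p)))
        \<le> (INF p\<in>{p. awalk u p v}. ereal (real (length p)))"
    proof (rule INF_greatest, clarify)
      fix p assume "awalk u p v"
      then show "(INF p\<in>{p. apath u p v}. ereal (real (length p))) \<le> ereal (real (length p))"
      proof (induct rule: awalk_to_apath_induct)
        case (path p)
        then show ?case by (auto simp: apath_def intro: INF_lower)
      next
        case (decomp p q r s)
        then have "length (q @ s) \<le> length p" by (auto elim: awalk_cyc_decompE)
        then have "ereal (real (length (q @ s))) \<le> ereal (real (length p))" by simp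
        with decomp show ?case by (meson order_trans)
      qed
    qed
  qed
qed

definition two_proper_coloring :: "'a pair_pre_digraph \<Rightarrow> nat \<Rightarrow> ('a \<Rightarrow> nat) \<Rightarrow> bool" where
  "two_proper_coloring G k f \<longleftrightarrow>
     f ` pverts G \<subseteq> {1..k} \<and>
     (\<forall>u \<in> pverts G. \<forall>v \<in> pverts G. graph_dist G u v = 2 \<longrightarrow> f u \<noteq> f v)"

definition two_proper_chromatic_number :: "'a pair_pre_digraph \<Rightarrow> nat" (\<open>\<chi>\<^sub>2\<close>) where
  "\<chi>\<^sub>2 G = (LEAST k. \<exists>f. two_proper_coloring G k f)"

lemma two_proper_coloring_exists:
  assumes "pair_graph G"
  shows "\<exists>k f. two_proper_coloring G k f"
proof -
  interpret pair_graph G by fact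
  obtain f where f: "bij_betw f (pverts G) {1..card (pverts G)}"
    using pair_finite_verts finite_same_card_bij[of "pverts G" "{1..card (pverts G)}"] by auto
  have "u = v \<Longrightarrow> u \<in> pverts G \<Longrightarrow> graph_dist G u v \<le> 0" for u v
    unfolding graph_dist_path[OF assms]
    by (rule INF_lower2[of "[]"]) (auto simp: apath_Nil_iff)
  then have "u \<noteq> v" if "u \<in> pverts G" "graph_dist G u v = 2" for u v
    using that by force
  with f have "two_proper_coloring G (card (pverts G)) f"
    unfolding two_proper_coloring_def bij_betw_def inj_on_def by blast
  then show ?thesis by blast
qed

end

theory Submission
  imports Defs
begin

text \<open>
  Vertices at distance 2 are distinct and nonadjacent, so a proper coloring of the complement of
  a graph is a 2-proper coloring of the graph itself. The last inequality thus follows from the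
  Nordhaus--Gaddum bound on the sum of the chromatic numbers of a graph and its complement. That
  bound is proved by induction on the number of vertices: given
  colorings with \<open>k\<close> and \<open>l\<close> colors, a new vertex has fewer than \<open>k\<close> neighbors or fewer than \<open>l\<close>
  non-neighbors, unless \<open>k + l\<close> is at most the number of old vertices. So either one of the two
  colorings extends without a new color, or both may use one.
\<close>

text \<open>The vertex set is kept apart from the adjacency relation, so that induction can enlarge
  \<open>A\<close> while \<open>R\<close> stays fixed and the complement is simply the negation of
  \<open>R\<close>. The guard \<open>u \<noteq> v\<close> keeps that negation from creating
  loops.\<close>

definition proper_coloring_on :: "'a set \<Rightarrow> ('a \<Rightarrow> 'a \<Rightarrow> bool) \<Rightarrow> nat \<Rightarrow> ('a \<Rightarrow> nat) \<Rightarrow> bool" where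
  "proper_coloring_on A R k f \<longleftrightarrow>
     f ` A \<subseteq> {1..k} \<and> (\<forall>u\<in>A. \<forall>v\<in>A. u \<noteq> v \<longrightarrow> R u v \<longrightarrow> f u \<noteq> f v)"

lemma proper_coloring_on_fun_upd:
  assumes "symp R" and "x \<notin> A" and "proper_coloring_on A R k f"
    and "c \<in> {1..k}" and "c \<notin> f ` {u \<in> A. R x u}"
  shows "proper_coloring_on (insert x A) R k (f(x := c))"
  unfolding proper_coloring_on_def
proof (intro conjI ballI impI)
  show "(f(x := c)) ` insert x A \<subseteq> {1..k}"
    using assms(3,4) by (auto simp: proper_coloring_on_def)
  fix u v assume uv: "u \<in> insert x A" "v \<in> insert x A" "u \<noteq> v" "R u v"
  \<comment> \<open>\<open>c\<close> avoids the colors of those \<open>u\<close> with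
    \<open>R x u\<close>; symmetry brings pairs with \<open>x\<close> in second place under the same
    condition.\<close>
  have "R v u"
    using assms(1) uv(4) by (rule sympD)
  then consider "u = x" "v \<in> A" "R x v" | "v = x" "u \<in> A" "R x u" | "u \<in> A" "v \<in> A" "u \<noteq> x" "v \<noteq> x"
    using uv by blast
  then show "(f(x := c)) u \<noteq> (f(x := c)) v"
  proof cases
    case 1
    then show ?thesis using assms(5) uv(3) by auto
  next
    case 2
    then show ?thesis using assms(5) uv(3) by auto
  next
    case 3
    then show ?thesis using assms(3) uv(3,4) by (simp add: proper_coloring_on_def)
  qed
qed

text \<open>Pigeonhole: fewer than \<open>k\<close> neighbors cannot use up all \<open>k\<close>
  colors, and any color left over is safe for \<open>x\<close>.\<close>

lemma proper_coloring_on_insert_same: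
  assumes "finite A" and "symp R" and "x \<notin> A" and "proper_coloring_on A R k f"
    and "card {u \<in> A. R x u} < k"
  shows "\<exists>h. proper_coloring_on (insert x A) R k h"
proof -
  have "\<not> {1..k} \<subseteq> f ` {u \<in> A. R x u}"
  proof
    assume "{1..k} \<subseteq> f ` {u \<in> A. R x u}"
    then have "card {1..k} \<le> card {u \<in> A. R x u}"
      using assms(1) by (intro surj_card_le) auto
    with assms(5) show False by simp
  qed
  then obtain c where "c \<in> {1..k}" "c \<notin> f ` {u \<in> A. R x u}" by blast
  with assms(2-4) show ?thesis by (blast intro: proper_coloring_on_fun_upd)
qed

lemma proper_coloring_on_insert_Suc:
  assumes "symp R" and "x \<notin> A" and "proper_coloring_on A R k f"
  shows "\<exists>h. proper_coloring_on (insert x A) R (Suc k) h"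
proof -
  have range: "f ` A \<subseteq> {1..k}"
    using assms(3) by (simp add: proper_coloring_on_def)
  moreover have "{1..k} \<subseteq> {1..Suc k}" by simp
  ultimately have "proper_coloring_on A R (Suc k) f"
    using assms(3) unfolding proper_coloring_on_def by blast
  moreover have "Suc k \<notin> f ` {u \<in> A. R x u}"
    using range by (auto simp: image_subset_iff)
  ultimately have "proper_coloring_on (insert x A) R (Suc k) (f(x := Suc k))"
    using assms(1,2) by (intro proper_coloring_on_fun_upd) auto
  then show ?thesis by blast
qed

lemma Nordhaus_Gaddum:
  assumes "finite A" and "symp R"
  shows "\<exists>k l f g. k + l \<le> card A + 1
    \<and> proper_coloring_on A R k f \<and> proper_coloring_on A (\<lambda>u v. \<not> R u v) l g"
  using assms(1)
proof (induction A rule: finite_induct)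
  case empty
  \<comment> \<open>Without vertices both colorings may use 0 colors.\<close>
  have "proper_coloring_on {} S 0 f" for S :: "'a \<Rightarrow> 'a \<Rightarrow> bool" and f
    by (simp add: proper_coloring_on_def)
  then show ?case by (metis add_0 le0)
next
  case (insert x A)
  let ?S = "\<lambda>u v. \<not> R u v"
  have symS: "symp ?S"
    using assms(2) by (auto intro!: sympI dest: sympD)
  from insert.IH obtain k l f g where kl: "k + l \<le> card A + 1"
    and f: "proper_coloring_on A R k f" and g: "proper_coloring_on A ?S l g"
    by blast
  have fS: "\<exists>h. proper_coloring_on (insert x A) R (Suc k) h"
    using assms(2) insert.hyps(2) f by (rule proper_coloring_on_insert_Suc)
  have gS: "\<exists>h. proper_coloring_on (insert x A) ?S (Suc l) h"
    using symS insert.hyps(2) g by (rule proper_coloring_on_insert_Suc)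
  have "{u \<in> A. R x u} \<union> {u \<in> A. ?S x u} = A" by blast
  then have "card A = card {u \<in> A. R x u} + card {u \<in> A. ?S x u}"
    using insert.hyps(1) card_Un_disjoint[of "{u \<in> A. R x u}" "{u \<in> A. ?S x u}"] by force
  \<comment> \<open>If the first two cases fail, \<open>k\<close> and \<open>l\<close> are bounded
    by two cardinalities that add up to \<open>card A\<close>.\<close>
  then consider "card {u \<in> A. R x u} < k" | "card {u \<in> A. ?S x u} < l" | "k + l \<le> card A"
    by linarith
  then show ?case
  proof cases
    case 1
    have "\<exists>h. proper_coloring_on (insert x A) R k h"
      using insert.hyps(1) assms(2) insert.hyps(2) f 1 by (rule proper_coloring_on_insert_same)
    moreover have "k + Suc l \<le> card (insert x A) + 1"
      using kl insert.hyps by simp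
    ultimately show ?thesis using gS by blast
  next
    case 2
    have "\<exists>h. proper_coloring_on (insert x A) ?S l h"
      using insert.hyps(1) symS insert.hyps(2) g 2 by (rule proper_coloring_on_insert_same)
    moreover have "Suc k + l \<le> card (insert x A) + 1"
      using kl insert.hyps by simp
    ultimately show ?thesis using fS by blast
  next
    case 3
    \<comment> \<open>Here the old sum is one below the induction bound, which pays for the second
      new color.\<close>
    then have "Suc k + Suc l \<le> card (insert x A) + 1"
      using insert.hyps by simp
    then show ?thesis using fS gS by blast
  qed
qed

text \<open>The empty path would give distance at most 0, and a single arc at most 1.\<close>

lemma graph_dist_2_imp_nonadjacent:
  assumes "pair_graph G" and "u \<in> pverts G" and "graph_dist G u v = 2"
  shows "u \<noteq> v" and "(u, v) \<notin> parcs G"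
proof -
  interpret pair_graph G by fact
  show "u \<noteq> v"
  proof
    assume "u = v"
    with assms(2) have "graph_dist G u v \<le> 0"
      unfolding graph_dist_path[OF assms(1)]
      by (intro INF_lower2[of "[]"]) (auto simp: apath_Nil_iff)
    with assms(3) show False by simp
  qed
  show "(u, v) \<notin> parcs G"
  proof
    assume "(u, v) \<in> parcs G"
    then have "awalk u [(u, v)] v"
      using arc_implies_awalk[of "(u, v)"] by simp
    then have "\<mu> (\<lambda>_. 1) u v \<le> awalk_cost (\<lambda>_. 1) [(u, v)]"
      by (rule min_cost_le_walk_cost)
    then have "graph_dist G u v \<le> 1"
      unfolding graph_dist_def by (simp add: awalk_cost_def one_ereal_def)
    with assms(3) show False by simp
  qed
qed

lemma two_proper_chromatic_number_le:
  assumes "two_proper_coloring G k f"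
  shows "\<chi>\<^sub>2 G \<le> k"
  unfolding two_proper_chromatic_number_def using assms by (blast intro: Least_le)

text \<open>The minimum is attained, and the color of any vertex witnesses that
  \<open>{1..\<chi>\<^sub>2 G}\<close> is nonempty.\<close>

lemma two_proper_chromatic_number_ge_1:
  assumes "pair_graph G" and "pverts G \<noteq> {}"
  shows "1 \<le> \<chi>\<^sub>2 G"
proof -
  have "\<exists>f. two_proper_coloring G (\<chi>\<^sub>2 G) f"
    unfolding two_proper_chromatic_number_def
    using two_proper_coloring_exists[OF assms(1)] by (rule LeastI_ex)
  with assms(2) show ?thesis
    unfolding two_proper_coloring_def by fastforce
qed

lemma two_proper_chromatic_number_complement_sum_le:
  assumes "pair_graph G"
  shows "\<chi>\<^sub>2 G + \<chi>\<^sub>2 (graph_complement G) \<le> card (pverts G) + 1"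
proof -
  interpret pair_graph G by fact
  have "symp (\<lambda>u v. (u, v) \<in> parcs G)"
    using pair_sym_arcs by (auto simp: symmetric_def sym_def symp_def)
  from Nordhaus_Gaddum[OF pair_finite_verts this]
  obtain k l f g where kl: "k + l \<le> card (pverts G) + 1"
    and f: "proper_coloring_on (pverts G) (\<lambda>u v. (u, v) \<in> parcs G) k f"
    and g: "proper_coloring_on (pverts G) (\<lambda>u v. (u, v) \<notin> parcs G) l g"
    by blast
  \<comment> \<open>The roles cross over: \<open>g\<close>, proper for the complement, serves
    \<open>G\<close>, and \<open>f\<close>, proper for \<open>G\<close>, serves the
    complement.\<close>
  have "two_proper_coloring G l g"
    using g graph_dist_2_imp_nonadjacent[OF assms]
    unfolding two_proper_coloring_def proper_coloring_on_def by blast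
  then have "\<chi>\<^sub>2 G \<le> l"
    by (rule two_proper_chromatic_number_le)
  moreover have "two_proper_coloring (graph_complement G) k f"
    unfolding two_proper_coloring_def
  proof (intro conjI ballI impI)
    show "f ` pverts (graph_complement G) \<subseteq> {1..k}"
      using f by (simp add: proper_coloring_on_def graph_complement_def)
    fix u v assume uv: "u \<in> pverts (graph_complement G)" "v \<in> pverts (graph_complement G)"
      and "graph_dist (graph_complement G) u v = 2"
    \<comment> \<open>Distinct vertices that are nonadjacent in the complement are adjacent in
      \<open>G\<close>, where \<open>f\<close> separates them.\<close>
    note graph_dist_2_imp_nonadjacent[OF pair_graph_complement[OF assms] uv(1) this(3)]
    with uv have "u \<in> pverts G" "v \<in> pverts G" "u \<noteq> v" "(u, v) \<in> parcs G"
      by (auto simp: graph_complement_def)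
    with f show "f u \<noteq> f v"
      by (simp add: proper_coloring_on_def)
  qed
  then have "\<chi>\<^sub>2 (graph_complement G) \<le> k"
    by (rule two_proper_chromatic_number_le)
  ultimately show ?thesis
    using kl by linarith
qed

theorem theorem3:
  fixes G :: "'a pair_pre_digraph" and n :: nat
  assumes "pair_graph G"
    and "pverts G \<noteq> {}"
    and "card (pverts G) = n"
  shows "1 \<le> sqrt (real (\<chi>\<^sub>2 G) * real (\<chi>\<^sub>2 (graph_complement G)))
       \<and> sqrt (real (\<chi>\<^sub>2 G) * real (\<chi>\<^sub>2 (graph_complement G)))
           \<le> (real (\<chi>\<^sub>2 G) + real (\<chi>\<^sub>2 (graph_complement G))) / 2
       \<and> (real (\<chi>\<^sub>2 G) + real (\<chi>\<^sub>2 (graph_complement G))) / 2 \<le> (real n + 1) / 2"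
proof (intro conjI)
  let ?a = "\<chi>\<^sub>2 G" and ?b = "\<chi>\<^sub>2 (graph_complement G)"
  have "1 \<le> ?a"
    using assms(1,2) by (rule two_proper_chromatic_number_ge_1)
  \<comment> \<open>The complement has the same nonempty vertex set.\<close>
  moreover have "1 \<le> ?b"
    using pair_graph_complement[OF assms(1)] assms(2)
    by (intro two_proper_chromatic_number_ge_1) (simp_all add: graph_complement_def)
  ultimately have "1 \<le> ?a * ?b" by simp
  then have "1 \<le> real ?a * real ?b"
    by (metis of_nat_1 of_nat_le_iff of_nat_mult)
  then show "1 \<le> sqrt (real ?a * real ?b)" by simp
  show "sqrt (real ?a * real ?b) \<le> (real ?a + real ?b) / 2"
    by (rule arith_geo_mean_sqrt) auto
  have "real (?a + ?b) \<le> real (n + 1)"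
    using two_proper_chromatic_number_complement_sum_le[OF assms(1)] assms(3)
    by (simp only: of_nat_le_iff)
  then show "(real ?a + real ?b) / 2 \<le> (real n + 1) / 2" by simp
qed

end
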